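(* Let $G$ be a finite graph and let $S(G)$ be its simplex graph. Then $$\left\lceil\frac{\omega(G)+1}{2}\right\rceil\le c(S(G))\le\left\lceil\frac{\chi(G)+1}{2}\right\rceil ,$$ where $\omega$ denotes the clique number, $\chi$ the chromatic number and $c$ the cop number. In particular, if $G$ is perfect, then $$c(S(G))=\left\lceil\frac{\omega(G)+1}{2}\right\rceil=\left\lceil\frac{\chi(G)+1}{2}\right\rceil .$$
   Context: All graphs are finite, simple and undirected. The graph $G$ need not be connected and may be the empty graph (no vertices), for which $\omega=\chi=0$ by convention. A clique of $G$ is a set of pairwise adjacent vertices. The simplex graph $S(G)$ has as vertices all cliques of $G$, including the empty clique (and singletons); two cliques $A,B$ are adjacent iff $|A\mathbin{\triangle}B|=1$. The graph $S(G)$ is connected. A graph $G$ is perfect if every induced subgraph $H$ of $G$ satisfies $\chi(H)=\omega(H)$. Cops and Robbers: on a connected graph, the cops first choose initial vertices (several cops may share a vertex), then the robber chooses an initial vertex. The sides then move alternately, cops first; on the cops' turn every cop, and on the robber's turn the robber, either stays or moves to an adjacent vertex. All positions are visible to all players. The cops win if at some time a cop occupies the robber's vertex; the robber wins if he evades capture forever. The cop number $c$ of the graph is the minimum number of cops that guarantees capture. *)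

theory Defs
  imports Complex_Main "Graph_Theory.Digraph_Component" "Graph_Theory.Pair_Digraph"
begin

text \<open>
  A finite simple undirected graph is a \<open>pair_graph\<close>: a finite vertex set \<open>pverts G\<close>, possibly
  empty, together with a symmetric irreflexive relation \<open>parcs G\<close> on it.
\<close>

definition is_clique :: "'a pair_pre_digraph \<Rightarrow> 'a set \<Rightarrow> bool" where
  "is_clique G K \<longleftrightarrow> K \<subseteq> pverts G \<and> (\<forall>u\<in>K. \<forall>v\<in>K. u \<noteq> v \<longrightarrow> (u, v) \<in> parcs G)"

definition clique_number :: "'a pair_pre_digraph \<Rightarrow> nat" where
  "clique_number G = Max (card ` {K. is_clique G K})"

definition proper_coloring :: "'a pair_pre_digraph \<Rightarrow> nat \<Rightarrow> ('a \<Rightarrow> nat) \<Rightarrow> bool" where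
  "proper_coloring G k f \<longleftrightarrow>
     (\<forall>v\<in>pverts G. f v < k) \<and> (\<forall>(u, v)\<in>parcs G. f u \<noteq> f v)"

definition chromatic_number :: "'a pair_pre_digraph \<Rightarrow> nat" where
  "chromatic_number G = (LEAST k. \<exists>f. proper_coloring G k f)"

definition perfect :: "'a pair_pre_digraph \<Rightarrow> bool" where
  "perfect G \<longleftrightarrow>
     (\<forall>H :: 'a pair_pre_digraph. induced_subgraph (with_proj H) (with_proj G) \<longrightarrow>
        chromatic_number H = clique_number H)"

definition simplex_graph :: "'a pair_pre_digraph \<Rightarrow> 'a set pair_pre_digraph" where
  "simplex_graph G =
     \<lparr> pverts = {K. is_clique G K},
       parcs = {(A, B). is_clique G A \<and> is_clique G B \<and> card ((A - B) \<union> (B - A)) = 1} \<rparr>"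

definition stay_or_step :: "'a pair_pre_digraph \<Rightarrow> 'a \<Rightarrow> 'a \<Rightarrow> bool" where
  "stay_or_step G u v \<longleftrightarrow> u = v \<or> (u, v) \<in> parcs G"

text \<open>\<open>r t\<close> is the robber's vertex after his initial choice and \<open>t\<close> further moves.\<close>

definition robber_walk :: "'a pair_pre_digraph \<Rightarrow> (nat \<Rightarrow> 'a) \<Rightarrow> bool" where
  "robber_walk G r \<longleftrightarrow> r 0 \<in> pverts G \<and> (\<forall>t. stay_or_step G (r t) (r (Suc t)))"

text \<open>
  A strategy \<open>\<sigma>\<close> maps the list of all robber positions seen so far to the list of the cops'
  positions: \<open>\<sigma> []\<close> is the initial placement, chosen before the robber's, and
  \<open>cops_at \<sigma> r t\<close> is the position of the cops after their \<open>t\<close>-th move, which may depend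
  on \<open>r 0, \<dots>, r (t - 1)\<close> only. The cops' own past positions are determined by \<open>\<sigma>\<close>
  and these. A list may contain a vertex several times.
\<close>

definition cops_at :: "('a list \<Rightarrow> 'a list) \<Rightarrow> (nat \<Rightarrow> 'a) \<Rightarrow> nat \<Rightarrow> 'a list" where
  "cops_at \<sigma> r t = \<sigma> (map r [0..<t])"

definition cop_strategy :: "'a pair_pre_digraph \<Rightarrow> nat \<Rightarrow> ('a list \<Rightarrow> 'a list) \<Rightarrow> bool" where
  "cop_strategy G k \<sigma> \<longleftrightarrow>
     length (\<sigma> []) = k \<and> set (\<sigma> []) \<subseteq> pverts G \<and>
     (\<forall>r. robber_walk G r \<longrightarrow>
        (\<forall>t. list_all2 (stay_or_step G) (cops_at \<sigma> r t) (cops_at \<sigma> r (Suc t))))"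

text \<open>
  The robber, at \<open>r t\<close>, can be caught right after he got there, when the cops stand at
  \<open>cops_at \<sigma> r t\<close>, or by the next move of the cops, to \<open>cops_at \<sigma> r (Suc t)\<close>.
\<close>

definition captures :: "('a list \<Rightarrow> 'a list) \<Rightarrow> (nat \<Rightarrow> 'a) \<Rightarrow> bool" where
  "captures \<sigma> r \<longleftrightarrow>
     (\<exists>t. r t \<in> set (cops_at \<sigma> r t) \<or> r t \<in> set (cops_at \<sigma> r (Suc t)))"

definition cops_win :: "'a pair_pre_digraph \<Rightarrow> nat \<Rightarrow> bool" where
  "cops_win G k \<longleftrightarrow>
     (\<exists>\<sigma>. cop_strategy G k \<sigma> \<and> (\<forall>r. robber_walk G r \<longrightarrow> captures \<sigma> r))"

definition cop_number :: "'a pair_pre_digraph \<Rightarrow> nat" where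
  "cop_number G = (LEAST k. cops_win G k)"

lemma pair_graph_simplex_graph:
  assumes "pair_graph G"
  shows "pair_graph (simplex_graph G)"
proof -
  interpret pair_graph G by (rule assms)
  have fin: "finite {K. is_clique G K}"
    by (rule finite_subset[of _ "Pow (pverts G)"]) (auto simp: is_clique_def pair_finite_verts)
  have "finite {(A, B). is_clique G A \<and> is_clique G B \<and> card ((A - B) \<union> (B - A)) = 1}"
    by (rule finite_subset[OF _ finite_cartesian_product[OF fin fin]]) auto
  with fin show ?thesis
    by unfold_locales (auto simp: simplex_graph_def symmetric_def sym_def Un_commute)
qed

end

theory Submission
  imports Defs
begin

text \<open>
  Lower bound. Fix a maximum clique \<open>K\<close>. The robber stays in the hypercube of subsets of \<open>K\<close> and
  plays against the shadows \<open>A \<inter> K\<close> of the cops. A cop at distance 2 threatens two of the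
  \<open>card K\<close> neighbours of the robber, a cop at distance 1 only one of them, and any other cop none.
  So \<open>k\<close> cops with \<open>2 * k \<le> card K\<close> leave a safe neighbour, unless none of them is at distance 1,
  in which case the robber stays.

  Upper bound. Properly colour \<open>G\<close> with \<open>2 * m + 1\<close> colours and split these into \<open>m\<close> pairs and
  one singleton, one cop per group. All cops start at the empty clique and
  always return to a subset of the robber's clique \<open>R\<close>. A cop whose gap \<open>R - C\<close> is larger than his
  group closes it by a vertex of a colour outside his group, so that the gap gets filled with
  colours of the group. He does not close a gap of exactly the size of his group, except to capture.
  Weighing a vertex of the gap by 1 if its colour is in the group of the cop and by 3 otherwise, the
  total weight plus \<open>card R\<close> decreases in each round: removals decrease \<open>card R\<close>, additions
  decrease the weight for the cop in charge of the new colour by 2, and after a pass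
  the cop of the singleton group closes in.
\<close>

section \<open>Moves in the simplex graph\<close>

lemma pverts_simplex_graph [simp]: "A \<in> pverts (simplex_graph G) \<longleftrightarrow> is_clique G A"
  by (simp add: simplex_graph_def)

lemma stay_or_step_simplex_iff:
  "stay_or_step (simplex_graph G) A B \<longleftrightarrow>
     A = B \<or> is_clique G A \<and> is_clique G B \<and> card (sym_diff A B) = 1"
  by (auto simp: stay_or_step_def simplex_graph_def)

lemma is_clique_subset: "is_clique G K \<Longrightarrow> A \<subseteq> K \<Longrightarrow> is_clique G A"
  unfolding is_clique_def by blast

lemma is_clique_empty: "is_clique G {}"
  by (simp add: is_clique_def)

lemma stay_or_step_simplex_cases:
  assumes "stay_or_step (simplex_graph G) R R'"
  obtains "R' = R" | v where "v \<notin> R" "R' = insert v R" | v where "v \<in> R" "R' = R - {v}"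
proof (cases "R' = R")
  case False
  with assms have "card (sym_diff R R') = 1"
    by (auto simp: stay_or_step_simplex_iff)
  then obtain v where v: "sym_diff R R' = {v}"
    by (rule card_1_singletonE)
  have iff: "x \<in> R' \<longleftrightarrow> (x \<in> R \<longleftrightarrow> x \<noteq> v)" for x
    using eqset_imp_iff[OF v, of x] by auto
  show ?thesis
  proof (cases "v \<in> R")
    case True
    then have "R' = R - {v}" by (auto simp: iff)
    with True show ?thesis by (rule that(3))
  next
    case False
    then have "R' = insert v R" by (auto simp: iff)
    with False show ?thesis by (rule that(2))
  qed
qed (rule that(1))

lemma stay_or_step_insert:
  assumes "is_clique G (insert x C)"
  shows "stay_or_step (simplex_graph G) C (insert x C)"
proof (cases "x \<in> C")
  case False
  then have "sym_diff C (insert x C) = {x}" by auto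
  then have "card (sym_diff C (insert x C)) = 1" by simp
  with assms show ?thesis
    using is_clique_subset[OF assms, of C] unfolding stay_or_step_simplex_iff by blast
qed (simp add: insert_absorb stay_or_step_def)

lemma stay_or_step_Diff:
  assumes "is_clique G C"
  shows "stay_or_step (simplex_graph G) C (C - {x})"
proof (cases "x \<in> C")
  case True
  then have "sym_diff C (C - {x}) = {x}" by auto
  then have "card (sym_diff C (C - {x})) = 1" by simp
  with assms show ?thesis
    using is_clique_subset[OF assms, of "C - {x}"] unfolding stay_or_step_simplex_iff by blast
qed (simp add: stay_or_step_def)

lemma robber_walk_is_clique:
  assumes "robber_walk (simplex_graph G) r"
  shows "is_clique G (r t)"
proof (induction t)
  case 0
  then show ?case using assms by (simp add: robber_walk_def)
next
  case (Suc t)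
  have "stay_or_step (simplex_graph G) (r t) (r (Suc t))"
    using assms by (simp add: robber_walk_def)
  with Suc show ?case by (auto simp: stay_or_step_simplex_iff)
qed

section \<open>The robber in a hypercube\<close>

text \<open>If \<open>D\<close> is where a cop's shadow and the robber differ, flipping coordinate
  \<open>v\<close> of the robber turns \<open>D\<close> into \<open>sym_diff D {v}\<close>. A flip
  outside the nonempty \<open>D\<close> gives distance at least 2; a flip inside lowers the distance
  by one, which is enough for a threat only if \<open>card D\<close> is at most 2. So all of
  \<open>D\<close> is threatened or nothing is.\<close>

lemma threatened_coordinates:
  assumes "finite D" "D \<noteq> {}"
  shows "{v. card (sym_diff D {v}) \<le> 1} \<subseteq> D"
    and "card {v. card (sym_diff D {v}) \<le> 1} \<le> 2"
    and "card D = 1 \<Longrightarrow> card {v. card (sym_diff D {v}) \<le> 1} \<le> 1"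
proof -
  have sub: "v \<in> D \<and> card D \<le> 2" if "card (sym_diff D {v}) \<le> 1" for v
  proof (cases "v \<in> D")
    case True
    then have "sym_diff D {v} = D - {v}" by auto
    with that True assms show ?thesis by (simp add: card_Diff_singleton)
  next
    case False
    then have "sym_diff D {v} = insert v D" by auto
    with that False assms show ?thesis by (simp add: card_gt_0_iff)
  qed
  show subset: "{v. card (sym_diff D {v}) \<le> 1} \<subseteq> D"
    by (rule subsetI, drule CollectD, drule sub, erule conjunct1)
  note le = card_mono[OF assms(1) subset]
  show "card {v. card (sym_diff D {v}) \<le> 1} \<le> 2"
  proof (cases "card D \<le> 2")
    case True
    then show ?thesis by (rule order.trans[OF le])
  next
    case False
    then have "\<not> card (sym_diff D {v}) \<le> 1" for v
      using sub[of v] by linarith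
    then show ?thesis by (simp only: Collect_empty_eq simp_thms card.empty zero_le empty_def[symmetric])
  qed
  show "card {v. card (sym_diff D {v}) \<le> 1} \<le> 1" if "card D = 1"
    using le that by (simp only:)
qed

text \<open>Distance 2 is the target because a cop shortens a distance by at most one per move, so
  the robber survives the next move of the cops.\<close>

lemma hypercube_escape:
  assumes "finite K" "R \<subseteq> K" "set As \<subseteq> Pow K" "R \<notin> set As" "2 * length As \<le> card K"
  shows "\<exists>R'\<subseteq>K. (R' = R \<or> card (sym_diff R R') = 1) \<and> (\<forall>A\<in>set As. 2 \<le> card (sym_diff A R'))"
proof (cases "\<forall>A\<in>set As. 2 \<le> card (sym_diff A R)")
  case True
  then show ?thesis using assms(2) by (intro exI[of _ R] conjI disjI1 refl)
next
  case False
  define threat where "threat A = {v. card (sym_diff (sym_diff A R) {v}) \<le> 1}" for A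
  have fin: "finite (sym_diff A R)" if "A \<in> set As" for A
    using that assms(1-3) by (auto intro: finite_subset)
  have ne: "sym_diff A R \<noteq> {}" if "A \<in> set As" for A
  proof -
    have "A \<noteq> R" using that assms(4) by metis
    then show ?thesis by auto
  qed
  obtain A0 where A0: "A0 \<in> set As" "\<not> 2 \<le> card (sym_diff A0 R)"
    using False by blast
  have "card (sym_diff A0 R) = 1"
  proof -
    have "card (sym_diff A0 R) \<noteq> 0"
      using fin[OF A0(1)] ne[OF A0(1)] by (metis card_eq_0_iff)
    then show ?thesis using A0(2) by linarith
  qed
  then have A0_le: "card (threat A0) \<le> 1"
    unfolding threat_def by (rule threatened_coordinates(3)[OF fin[OF A0(1)] ne[OF A0(1)]])
  have fin_threat: "finite (threat A)" if "A \<in> set As" for A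
    unfolding threat_def
    by (rule finite_subset[OF threatened_coordinates(1)[OF fin[OF that] ne[OF that]] fin[OF that]])
  have le: "card (threat A) \<le> 2" if "A \<in> set As" for A
    unfolding threat_def by (rule threatened_coordinates(2)[OF fin[OF that] ne[OF that]])
  \<comment> \<open>Union bound with one term at most 1 and all others at most 2: the cop at
    distance 1 supplies the strict inequality.\<close>
  have "card (\<Union>A\<in>set As. threat A) \<le> (\<Sum>A\<in>set As. card (threat A))"
    by (intro card_UN_le) simp
  also have "\<dots> = card (threat A0) + (\<Sum>A\<in>set As - {A0}. card (threat A))"
    using A0(1) by (simp add: sum.remove)
  also have "\<dots> \<le> 1 + (\<Sum>A\<in>set As - {A0}. 2)"
    by (intro add_mono A0_le sum_mono le) auto
  also have "\<dots> < 2 * card (set As)"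
    using A0(1) card_gt_0_iff[of "set As"] by (auto simp: card_Diff_singleton)
  also have "\<dots> \<le> card K"
    using card_length[of As] assms(5) by linarith
  finally have "\<not> K \<subseteq> (\<Union>A\<in>set As. threat A)"
    using card_mono[of "\<Union>A\<in>set As. threat A" K] fin_threat by (meson finite_UN finite_set not_le)
  then obtain v where v: "v \<in> K" "\<And>A. A \<in> set As \<Longrightarrow> v \<notin> threat A"
    by (meson UN_I subsetI)
  have "card (sym_diff R (sym_diff R {v})) = 1"
  proof -
    have "sym_diff R (sym_diff R {v}) = {v}" by auto
    then show ?thesis by simp
  qed
  moreover have "2 \<le> card (sym_diff A (sym_diff R {v}))" if "A \<in> set As" for A
  proof -
    have "sym_diff A (sym_diff R {v}) = sym_diff (sym_diff A R) {v}" by auto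
    then show ?thesis using v(2)[OF that] by (simp add: threat_def)
  qed
  moreover have "sym_diff R {v} \<subseteq> K" using assms(2) v(1) by auto
  ultimately show ?thesis by (intro exI[of _ "sym_diff R {v}"] conjI disjI2 ballI)
qed

text \<open>Shadows of \<open>A\<close> and \<open>B\<close> differ only where \<open>A\<close> and
  \<open>B\<close> do, so a cop's move is at most one move of his shadow; the rest is the triangle
  inequality.\<close>

lemma shadow_step:
  assumes "stay_or_step (simplex_graph G) A B" "finite K" "R \<subseteq> K"
  shows "card (sym_diff (A \<inter> K) R) \<le> card (sym_diff (B \<inter> K) R) + 1"
proof -
  have AB: "finite (sym_diff A B) \<and> card (sym_diff A B) \<le> 1"
    using assms(1) unfolding stay_or_step_simplex_iff
  proof
    assume "A = B"
    then show ?thesis by simp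
  next
    assume "is_clique G A \<and> is_clique G B \<and> card (sym_diff A B) = 1"
    then have "card (sym_diff A B) = 1" by (elim conjE)
    \<comment> \<open>Infinite sets have \<open>card\<close> 0, so cardinality 1 yields
      finiteness.\<close>
    from card_ge_0_finite[of "sym_diff A B"] this show ?thesis
      by (simp del: finite_Un)
  qed
  have "finite (sym_diff (B \<inter> K) R)"
    using assms(2,3) by (auto intro: finite_subset)
  moreover have "sym_diff (A \<inter> K) R \<subseteq> sym_diff (B \<inter> K) R \<union> sym_diff A B" by auto
  ultimately have "card (sym_diff (A \<inter> K) R) \<le> card (sym_diff (B \<inter> K) R \<union> sym_diff A B)"
    using conjunct1[OF AB] by (intro card_mono finite_UnI[of "sym_diff (B \<inter> K) R"])
  also have "\<dots> \<le> card (sym_diff (B \<inter> K) R) + card (sym_diff A B)"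
    by (rule card_Un_le)
  also have "\<dots> \<le> card (sym_diff (B \<inter> K) R) + 1"
    by (rule add_left_mono[OF conjunct2[OF AB]])
  finally show ?thesis .
qed

text \<open>Against a fixed strategy, every finite safe history extends by one safe position, and
  dependent choice glues the extensions into an infinite walk.\<close>

lemma clique_evasion:
  assumes K: "is_clique G K" "finite K" and k: "2 * k \<le> card K"
  shows "\<not> cops_win (simplex_graph G) k"
proof
  let ?S = "simplex_graph G"
  assume "cops_win ?S k"
  then obtain \<sigma> where \<sigma>: "cop_strategy ?S k \<sigma>"
    and win: "\<And>r. robber_walk ?S r \<Longrightarrow> captures \<sigma> r"
    by (auto simp: cops_win_def)
  \<comment> \<open>\<open>h\<close> lists the robber's positions before \<open>R\<close>, so
    \<open>\<sigma> h\<close> is where the cops stand when he arrives at \<open>R\<close>.\<close>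
  define safe where "safe h R \<longleftrightarrow> (\<forall>A\<in>set (\<sigma> h). 2 \<le> card (sym_diff (A \<inter> K) R))" for h R
  have escape: "\<exists>R'\<subseteq>K. stay_or_step ?S R R' \<and> safe h R'"
    if "R \<subseteq> K" "length (\<sigma> h) = k" "\<And>A. A \<in> set (\<sigma> h) \<Longrightarrow> A \<inter> K \<noteq> R" for R h
  proof -
    have "\<exists>R'\<subseteq>K. (R' = R \<or> card (sym_diff R R') = 1)
        \<and> (\<forall>A\<in>set (map (\<lambda>A. A \<inter> K) (\<sigma> h)). 2 \<le> card (sym_diff A R'))"
      using K that k by (intro hypercube_escape) auto
    then obtain R' where R': "R' \<subseteq> K" "R' = R \<or> card (sym_diff R R') = 1" "safe h R'"
      by (auto simp: safe_def)
    have "stay_or_step ?S R R'"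
      unfolding stay_or_step_simplex_iff
      using R' is_clique_subset[OF K(1)] that(1) by blast
    with R' show ?thesis by blast
  qed
  define walk where "walk n h \<longleftrightarrow> length h = Suc n \<and> (\<forall>i\<le>n. h ! i \<subseteq> K \<and> safe (take i h) (h ! i))
    \<and> (\<forall>i<n. stay_or_step ?S (h ! i) (h ! Suc i))" for n h
  have len0: "length (\<sigma> []) = k" using \<sigma> by (simp add: cop_strategy_def)
  \<comment> \<open>The rules bind \<open>\<sigma>\<close> only along robber walks, so the number of
    cops is known to be constant only on their histories.\<close>
  have len: "length (\<sigma> (map r [0..<t])) = k" if "robber_walk ?S r" for r t
  proof (induction t)
    case (Suc t)
    have "list_all2 (stay_or_step ?S) (cops_at \<sigma> r t) (cops_at \<sigma> r (Suc t))"
      using \<sigma> that by (simp add: cop_strategy_def)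
    with Suc show ?case by (auto simp: cops_at_def dest: list_all2_lengthD)
  qed (simp add: len0)
  have dodged: "A \<inter> K \<noteq> r t"
    if "robber_walk ?S r" "r t \<subseteq> K" "safe (map r [0..<t]) (r t)" and A: "A \<in> set (\<sigma> (map r [0..<Suc t]))"
    for r t A
  proof -
    have "list_all2 (stay_or_step ?S) (cops_at \<sigma> r t) (cops_at \<sigma> r (Suc t))"
      using \<sigma> that(1) by (simp add: cop_strategy_def)
    then obtain B where B: "B \<in> set (cops_at \<sigma> r t)" "stay_or_step ?S B A"
      using A unfolding cops_at_def by (metis list_all2_conv_all_nth in_set_conv_nth)
    then have "2 \<le> card (sym_diff (B \<inter> K) (r t))"
      using that(3) by (simp add: safe_def cops_at_def)
    then have "card (sym_diff (A \<inter> K) (r t)) \<noteq> 0"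
      using shadow_step[OF B(2) K(2) that(2)] by linarith
    then show ?thesis by auto
  qed
  have "\<exists>h. walk 0 h"
  proof -
    \<comment> \<open>Fewer than \<open>2 ^ card K\<close> cops leave some subset of
      \<open>K\<close> that is no shadow. An imaginary robber there escapes to a safe vertex, which
      serves as the actual start.\<close>
    have "card (set (map (\<lambda>A. A \<inter> K) (\<sigma> []))) \<le> k"
      using card_length[of "map (\<lambda>A. A \<inter> K) (\<sigma> [])"] len0 by simp
    also have "k \<le> card K" using k by simp
    also have "\<dots> < card (Pow K)" using K(2) by (simp add: card_Pow)
    finally have "\<not> Pow K \<subseteq> set (map (\<lambda>A. A \<inter> K) (\<sigma> []))"
      using card_mono[of "set (map (\<lambda>A. A \<inter> K) (\<sigma> []))" "Pow K"] by (metis finite_set not_le)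
    then obtain R where "R \<subseteq> K" "\<And>A. A \<in> set (\<sigma> []) \<Longrightarrow> A \<inter> K \<noteq> R" by auto
    from escape[OF this(1) len0 this(2)] obtain R' where "R' \<subseteq> K" "safe [] R'" by blast
    then have "walk 0 [R']" by (simp add: walk_def)
    then show ?thesis ..
  qed
  moreover have "\<exists>h'. walk (Suc n) h' \<and> (\<exists>R. h' = h @ [R])" if "walk n h" for n h
  proof -
    \<comment> \<open>The finite history is prolonged by staying at its last position forever,
      because the rules for \<open>\<sigma>\<close> speak of infinite walks.\<close>
    define r where "r i = h ! min i n" for i
    have h: "length h = Suc n" "\<And>i. i \<le> n \<Longrightarrow> h ! i \<subseteq> K" "\<And>i. i \<le> n \<Longrightarrow> safe (take i h) (h ! i)"
      "\<And>i. i < n \<Longrightarrow> stay_or_step ?S (h ! i) (h ! Suc i)"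
      using that by (auto simp: walk_def)
    have "stay_or_step ?S (r i) (r (Suc i))" for i
    proof (cases "i < n")
      case True
      then show ?thesis using h(4)[of i] by (simp add: r_def)
    next
      case False
      then show ?thesis by (simp add: r_def stay_or_step_def)
    qed
    then have r: "robber_walk ?S r"
      using is_clique_subset[OF K(1)] h(2)[of 0] by (auto simp: robber_walk_def r_def)
    have take: "map r [0..<i] = take i h" if "i \<le> Suc n" for i
      using that h(1) by (intro nth_equalityI) (auto simp: r_def)
    have rn: "r n = h ! n" and hn: "map r [0..<Suc n] = h"
      using take[of "Suc n"] h(1) by (auto simp: r_def simp del: upt_Suc)
    have "A \<inter> K \<noteq> h ! n" if "A \<in> set (\<sigma> h)" for A
      using dodged[OF r, of n A] h(2,3)[of n] that take[of n] rn hn by (simp del: upt_Suc)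
    moreover have "length (\<sigma> h) = k" using len[OF r, of "Suc n"] hn by simp
    ultimately obtain R where R: "R \<subseteq> K" "stay_or_step ?S (h ! n) R" "safe h R"
      using escape[of "h ! n" h] h(2)[of n] by blast
    have "walk (Suc n) (h @ [R])"
      using h R by (auto simp: walk_def nth_append le_Suc_eq less_Suc_eq)
    then show ?thesis by blast
  qed
  ultimately have "\<exists>H. \<forall>n. walk n (H n) \<and> (\<exists>R. H (Suc n) = H n @ [R])"
    by (intro dependent_nat_choice) auto
  then obtain H where H: "\<And>n. walk n (H n)" "\<And>n. \<exists>R. H (Suc n) = H n @ [R]" by blast
  \<comment> \<open>Since \<open>H\<close> grows by appending, the diagonal is a walk whose initial
    segments are the \<open>H n\<close>.\<close>
  define r where "r n = H n ! n" for n
  have lenH: "length (H n) = Suc n" for n using H(1)[of n] by (simp add: walk_def)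
  have HS: "H (Suc n) = H n @ [r (Suc n)]" for n
    using H(2)[of n] lenH[of n] by (auto simp: r_def nth_append)
  have Hr: "H n = map r [0..<Suc n]" for n
  proof (induction n)
    case 0
    then show ?case using lenH[of 0] by (auto simp: r_def length_Suc_conv)
  next
    case (Suc n)
    then show ?case using HS[of n] by simp
  qed
  have step: "stay_or_step ?S (r n) (r (Suc n))" for n
  proof -
    have "stay_or_step ?S (H (Suc n) ! n) (H (Suc n) ! Suc n)"
      using H(1)[of "Suc n"] by (simp add: walk_def)
    then show ?thesis by (simp add: Hr del: upt_Suc)
  qed
  have sub: "r n \<subseteq> K" for n using H(1)[of n] by (auto simp: walk_def r_def)
  have safe: "safe (map r [0..<n]) (r n)" for n
  proof -
    have "take n (H n) = map r [0..<n]" by (simp add: Hr)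
    then show ?thesis using H(1)[of n] by (auto simp: walk_def r_def)
  qed
  have walk: "robber_walk ?S r"
    using step sub[of 0] is_clique_subset[OF K(1)] by (auto simp: robber_walk_def)
  from win[OF this] obtain t
    where "r t \<in> set (\<sigma> (map r [0..<t])) \<or> r t \<in> set (\<sigma> (map r [0..<Suc t]))"
    unfolding captures_def cops_at_def by blast
  \<comment> \<open>A cop on the robber's vertex has a shadow at distance 0, against
    \<open>safe\<close> before the cops' move and against \<open>dodged\<close> after it.\<close>
  moreover have "r t \<inter> K = r t" using sub[of t] by blast
  ultimately show False
    using dodged[OF walk sub safe, of "r t" t] safe[of t] by (auto simp: safe_def simp del: upt_Suc)
qed

section \<open>The strategy of a cop\<close>

text \<open>\<open>g\<close> sends a vertex to the group of its colour, \<open>j\<close> is the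
  cop's group and \<open>s\<close> its size. The intersection is a single move in play: the cop
  stood inside the robber's previous clique, which lost at most one vertex. Capture is tested before
  waiting, so a gap of one vertex is always closed.\<close>

definition pursue :: "('a \<Rightarrow> nat) \<Rightarrow> nat \<Rightarrow> nat \<Rightarrow> 'a set \<Rightarrow> 'a set \<Rightarrow> 'a set" where
  "pursue g s j C R =
     (if \<not> C \<subseteq> R then C \<inter> R
      else if card (R - C) \<le> 1 then R
      else if card (R - C) \<le> s then C
      else insert (SOME x. x \<in> R - C \<and> g x \<noteq> j) C)"

text \<open>The difference 2 of the two weights exceeds the growth by 1 of the robber's clique when
  he adds a vertex. Both weights are positive, so a smaller gap is strictly lighter.\<close>

definition gap_weight :: "('a \<Rightarrow> nat) \<Rightarrow> nat \<Rightarrow> 'a set \<Rightarrow> nat" where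
  "gap_weight g j D = (\<Sum>x\<in>D. if g x = j then 1 else 3)"

lemma gap_weight_mono: "finite D \<Longrightarrow> D' \<subseteq> D \<Longrightarrow> gap_weight g j D' \<le> gap_weight g j D"
  unfolding gap_weight_def by (rule sum_mono2) auto

lemma gap_weight_strict_mono:
  assumes "finite D" "D' \<subset> D"
  shows "gap_weight g j D' < gap_weight g j D"
proof -
  obtain b where "b \<in> D - D'" using assms(2) by blast
  with assms show ?thesis
    unfolding gap_weight_def by (intro sum_strict_mono2[of D D' b]) auto
qed

text \<open>The choice in \<open>pursue\<close> succeeds by pigeonhole: at most \<open>s\<close>
  vertices of \<open>R\<close> lie in group \<open>j\<close>, so a larger gap contains another
  one.\<close>

lemma pursue_cases:
  assumes "finite R" "card {x \<in> R. g x = j} \<le> s" "C \<subseteq> R"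
  obtains (capture) "card (R - C) \<le> 1" "pursue g s j C R = R"
  | (wait) "1 < card (R - C)" "card (R - C) \<le> s" "pursue g s j C R = C"
  | (advance) x where "1 < card (R - C)" "s < card (R - C)" "x \<in> R - C" "g x \<noteq> j"
      "pursue g s j C R = insert x C"
proof -
  consider "card (R - C) \<le> 1" | "1 < card (R - C)" "card (R - C) \<le> s"
    | "1 < card (R - C)" "s < card (R - C)" by linarith
  then show ?thesis
  proof cases
    case 3
    have "\<not> R - C \<subseteq> {x \<in> R. g x = j}"
      using 3(2) assms(1,2) card_mono[of "{x \<in> R. g x = j}" "R - C"] by auto
    then have "\<exists>x. x \<in> R - C \<and> g x \<noteq> j" by blast
    from someI_ex[OF this] show ?thesis
      using 3 assms(3) by (intro advance[of "SOME x. x \<in> R - C \<and> g x \<noteq> j"]) (auto simp: pursue_def)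
  qed (use assms(3) capture wait in \<open>auto simp: pursue_def\<close>)
qed

lemma pursue_subset:
  assumes "finite R" "card {x \<in> R. g x = j} \<le> s"
  shows "pursue g s j C R \<subseteq> R"
proof (cases "C \<subseteq> R")
  case True
  from assms True show ?thesis by (cases rule: pursue_cases) (use True in auto)
qed (auto simp: pursue_def)

lemma pursue_step:
  assumes "finite R" "card {x \<in> R. g x = j} \<le> s" "is_clique G C" "is_clique G R" "C - R \<subseteq> {v}"
  shows "stay_or_step (simplex_graph G) C (pursue g s j C R)"
proof (cases "C \<subseteq> R")
  case True
  from assms(1,2) True show ?thesis
  proof (cases rule: pursue_cases)
    case capture
    show ?thesis
    proof (cases "R - C = {}")
      case False
      then have "card (R - C) = 1"
        using capture(1) assms(1) card_gt_0_iff[of "R - C"] by auto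
      then obtain x where "R - C = {x}" by (rule card_1_singletonE)
      then have "R = insert x C" using True by blast
      with capture assms(4) stay_or_step_insert show ?thesis by metis
    qed (use True capture in \<open>auto simp: stay_or_step_def\<close>)
  next
    case (advance x)
    then have "is_clique G (insert x C)" using True is_clique_subset[OF assms(4)] by simp
    with advance stay_or_step_insert show ?thesis by metis
  qed (simp add: stay_or_step_def)
next
  case False
  then have "pursue g s j C R = C - {v}" using assms(5) by (auto simp: pursue_def)
  with stay_or_step_Diff[OF assms(3)] show ?thesis by simp
qed

text \<open>A waiting cop faces a gap of at least 2, hence of at least \<open>s\<close>; this is
  where groups of at most two colours matter. An advancing cop takes one vertex from a gap larger
  than \<open>s\<close>.\<close>

lemma pursue_gap_ge:
  assumes "finite R" "card {x \<in> R. g x = j} \<le> s" "C \<subseteq> R" "s \<le> 2" "pursue g s j C R \<noteq> R"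
  shows "s \<le> card (R - pursue g s j C R)"
  using assms(1-3)
proof (cases rule: pursue_cases)
  case (advance x)
  have "R - pursue g s j C R = R - C - {x}" using advance by auto
  then show ?thesis using advance assms(1) by (simp add: card_Diff_singleton)
qed (use assms in auto)

lemma pursue_after_shrink:
  assumes "finite R'" "card {x \<in> R'. g x = j} \<le> s" "C \<subseteq> R" "R' \<subseteq> R"
  shows "R' - pursue g s j C R' \<subseteq> R - C"
proof (cases "C \<subseteq> R'")
  case True
  from assms(1,2) True show ?thesis by (cases rule: pursue_cases) (use assms in auto)
next
  case False
  then show ?thesis using assms by (auto simp: pursue_def)
qed

text \<open>For \<open>s\<close> equal to 1 the waiting case is contradictory. This is the reason
  for a singleton group: its cop makes progress even when the robber passes.\<close>

lemma pursue_after_pass: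
  assumes "finite R" "card {x \<in> R. g x = j} \<le> 1" "C \<subseteq> R" "C \<noteq> R"
  shows "R - pursue g 1 j C R \<subset> R - C"
  using assms(1-3) by (cases rule: pursue_cases) (use assms in auto)

text \<open>The new gap exceeds both \<open>s\<close> and 1, which forces an advance: a vertex of
  weight 3 leaves the gap while \<open>v\<close> enters with weight 1 or 3.\<close>

lemma pursue_after_insert:
  assumes "finite R" "card {x \<in> insert v R. g x = j} \<le> s" "C \<subseteq> R" "v \<notin> R"
    "s \<le> card (R - C)" "0 < s"
  shows "gap_weight g j (insert v R - pursue g s j C (insert v R)) + (if g v = j then 2 else 0)
    = gap_weight g j (R - C)"
proof -
  have gap: "insert v R - C = insert v (R - C)" using assms(3,4) by blast
  then have card: "card (insert v R - C) = Suc (card (R - C))" using assms(1,4) by simp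
  have "finite (insert v R)" "C \<subseteq> insert v R" using assms by auto
  from this(1) assms(2) this(2) show ?thesis
  proof (cases rule: pursue_cases)
    case (advance x)
    have "insert v R - pursue g s j C (insert v R) = insert v (R - C) - {x}"
      using advance gap by auto
    moreover have "gap_weight g j (insert v (R - C)) = 3 + gap_weight g j (insert v (R - C) - {x})"
      unfolding gap_weight_def
      by (subst sum.remove[of _ x]) (use advance gap assms(1) in auto)
    moreover have "gap_weight g j (insert v (R - C)) =
        (if g v = j then 1 else 3) + gap_weight g j (R - C)"
      unfolding gap_weight_def using assms by (subst sum.insert) auto
    ultimately show ?thesis by (auto split: if_splits)
  qed (use card assms(5,6) in auto)
qed

section \<open>The cops as a team\<close>

lemma coloring_cops_win:
  assumes G: "pair_graph G" and f: "proper_coloring G n f" and n: "n \<le> 2 * m + 1"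
  shows "cops_win (simplex_graph G) (Suc m)"
proof -
  let ?S = "simplex_graph G"
  interpret pair_graph G by (rule G)
  \<comment> \<open>Colours \<open>2 * j\<close> and \<open>2 * j + 1\<close> form group
    \<open>j\<close>; as all colours are at most \<open>2 * m\<close>, group \<open>m\<close> has at
    most the colour \<open>2 * m\<close>.\<close>
  define g where "g v = f v div 2" for v
  define s where "s j = (if j = m then 1 else 2 :: nat)" for j
  define c where "c h j = foldl (pursue g (s j) j) {} h" for h j
  define \<sigma> where "\<sigma> h = map (c h) [0..<Suc m]" for h
  have s: "0 < s j" "s j \<le> 2" for j by (auto simp: s_def)
  have finR: "finite R" if "is_clique G R" for R
    using that by (auto simp: is_clique_def intro: finite_subset pair_finite_verts)
  have g_le: "g v \<le> m" if "v \<in> R" "is_clique G R" for v R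
  proof -
    have "f v < n" using that f by (auto simp: is_clique_def proper_coloring_def)
    then show ?thesis using n unfolding g_def by linarith
  qed
  \<comment> \<open>A clique uses each colour at most once, so it has no more vertices in a group
    than the group has colours.\<close>
  have group: "card {x \<in> R. g x = j} \<le> s j" if "is_clique G R" for R j
  proof -
    have "inj_on f R"
      using that f by (fastforce simp: inj_on_def is_clique_def proper_coloring_def)
    then have "card {x \<in> R. g x = j} = card (f ` {x \<in> R. g x = j})"
      by (metis (no_types, lifting) card_image inj_on_subset mem_Collect_eq subsetI)
    also have "\<dots> \<le> card (if j = m then {2 * m} else {2 * j, 2 * j + 1})"
    proof (intro card_mono)
      have "f v < n" if "v \<in> R" for v
        using that \<open>is_clique G R\<close> f by (auto simp: is_clique_def proper_coloring_def)
      then show "f ` {x \<in> R. g x = j} \<subseteq> (if j = m then {2 * m} else {2 * j, 2 * j + 1})"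
        using n by (fastforce simp: g_def)
    qed auto
    also have "\<dots> = s j" by (simp add: s_def)
    finally show ?thesis .
  qed
  define C where "C r t j = c (map r [0..<t]) j" for r t j
  have C0: "C r 0 j = {}" and CS: "C r (Suc t) j = pursue g (s j) j (C r t j) (r t)" for r t j
    by (simp_all add: C_def c_def)
  have cops_at: "cops_at \<sigma> r t = map (C r t) [0..<Suc m]" for r t
    by (simp add: cops_at_def \<sigma>_def C_def)
  have C_sub: "C r (Suc t) j \<subseteq> r t" if "robber_walk ?S r" for r t j
    unfolding CS using robber_walk_is_clique[OF that] by (intro pursue_subset finR group)
  have C_step: "stay_or_step ?S (C r t j) (C r (Suc t) j)" if r: "robber_walk ?S r" for r t j
  proof (cases t)
    case 0
    show ?thesis unfolding CS unfolding 0 C0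
      by (rule pursue_step) (use robber_walk_is_clique[OF r] is_clique_empty in \<open>auto intro: finR group\<close>)
  next
    case (Suc u)
    have "stay_or_step ?S (r u) (r t)" using r Suc by (simp add: robber_walk_def)
    then obtain v where "r u - r t \<subseteq> {v}" by (rule stay_or_step_simplex_cases) auto
    then have "C r t j - r t \<subseteq> {v}" using C_sub[OF r, of u j] Suc by blast
    moreover have "is_clique G (C r t j)"
      using C_sub[OF r, of u j] Suc robber_walk_is_clique[OF r] is_clique_subset by blast
    ultimately show ?thesis
      unfolding CS by (intro pursue_step finR group robber_walk_is_clique[OF r])
  qed
  have "cop_strategy ?S (Suc m) \<sigma>"
    unfolding cop_strategy_def
  proof (intro conjI allI impI)
    show "length (\<sigma> []) = Suc m" by (simp add: \<sigma>_def)
    show "set (\<sigma> []) \<subseteq> pverts ?S" by (auto simp: \<sigma>_def c_def is_clique_empty)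
    show "list_all2 (stay_or_step ?S) (cops_at \<sigma> r t) (cops_at \<sigma> r (Suc t))"
      if "robber_walk ?S r" for r t
      unfolding cops_at using C_step[OF that] by (simp add: list_all2_conv_all_nth del: upt_Suc)
  qed
  moreover have "captures \<sigma> r" if r: "robber_walk ?S r" for r
  proof (rule ccontr)
    assume "\<not> captures \<sigma> r"
    then have free: "C r (Suc t) j \<noteq> r t" if "j \<le> m" for t j
      using that unfolding captures_def cops_at by (force simp del: upt_Suc)
    note clique = robber_walk_is_clique[OF r]
    define gap where "gap t j = r t - C r (Suc t) j" for t j
    have fin: "finite (gap t j)" for t j using finR[OF clique] by (simp add: gap_def)
    have step: "stay_or_step ?S (r t) (r (Suc t))" for t using r by (simp add: robber_walk_def)
    have subset: "s j \<le> card (gap t j)" if "j \<le> m" "C r t j \<subseteq> r t" for t j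
      unfolding gap_def CS
    proof (rule pursue_gap_ge)
      show "pursue g (s j) j (C r t j) (r t) \<noteq> r t" using free[OF that(1), of t] by (simp only: CS not_False_eq_True)
    qed (use that(2) s finR[OF clique] group[OF clique] in auto)
    \<comment> \<open>This invariant is what makes a cop advance whenever the robber adds a
      vertex.\<close>
    have gap_ge: "s j \<le> card (gap t j)" if "j \<le> m" for t j
    proof (induction t)
      case 0
      show ?case by (rule subset) (simp_all add: that C0)
    next
      case (Suc t)
      show ?case
      proof (cases "C r (Suc t) j \<subseteq> r (Suc t)")
        case True
        then show ?thesis by (rule subset[OF that])
      next
        \<comment> \<open>The robber dropped a vertex of the cop's clique and the cop drops it too,
          so the gap is unchanged.\<close>
        case False
        from step[of t] obtain v where "v \<in> C r (Suc t) j" "r (Suc t) = r t - {v}"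
          by (rule stay_or_step_simplex_cases) (use False C_sub[OF r, of t j] in auto)
        moreover have "C r (Suc (Suc t)) j = C r (Suc t) j \<inter> r (Suc t)"
          using False by (subst CS) (simp add: pursue_def)
        ultimately have "gap (Suc t) j = gap t j" unfolding gap_def by blast
        with Suc show ?thesis by simp
      qed
    qed
    define M where "M t = card (r t) + (\<Sum>j\<le>m. gap_weight g j (gap t j))" for t
    have dec: "M (Suc t) < M t" for t
    proof -
      have shrink: "gap (Suc t) j \<subseteq> gap t j" if "r (Suc t) \<subseteq> r t" for j
        unfolding gap_def CS[of r "Suc t"]
        by (rule pursue_after_shrink) (use that C_sub[OF r] finR[OF clique] group[OF clique] in auto)
      show ?thesis using step[of t]
      proof (cases rule: stay_or_step_simplex_cases)
        case 1
        \<comment> \<open>After a pass no gap grows, and that of cop \<open>m\<close> shrinks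
          strictly.\<close>
        have sm: "s m = 1" by (simp add: s_def)
        have "gap (Suc t) m \<subset> gap t m"
          unfolding gap_def CS[of r "Suc t"] 1 sm
          by (rule pursue_after_pass)
            (use C_sub[OF r, of t m] free[of m t] finR[OF clique] group[OF clique, of t m] sm in auto)
        then have "(\<Sum>j\<le>m. gap_weight g j (gap (Suc t) j)) < (\<Sum>j\<le>m. gap_weight g j (gap t j))"
        proof (intro sum_strict_mono_ex1 ballI bexI)
          show "gap_weight g j (gap (Suc t) j) \<le> gap_weight g j (gap t j)" for j
            using 1 by (intro gap_weight_mono fin shrink) simp
        qed (auto intro: gap_weight_strict_mono fin)
        with 1 show ?thesis by (simp add: M_def)
      next
        case (2 v)
        have w: "gap_weight g j (gap (Suc t) j) + (if g v = j then 2 else 0) = gap_weight g j (gap t j)"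
          if "j \<le> m" for j
          unfolding gap_def CS[of r "Suc t"] 2(2)
          by (rule pursue_after_insert)
            (use 2 C_sub[OF r, of t j] finR[OF clique] group[OF clique, of "Suc t" j]
              s gap_ge[OF that, of t] in \<open>auto simp: gap_def\<close>)
        \<comment> \<open>Only the weight for cop \<open>g v\<close> falls, by 2, against the growth
          of \<open>card (r t)\<close> by 1; the bound places this cop in the sum.\<close>
        have "g v \<le> m" using g_le clique[of "Suc t"] 2 by blast
        then have "(\<Sum>j\<le>m. gap_weight g j (gap t j)) = (\<Sum>j\<le>m. gap_weight g j (gap (Suc t) j)) + 2"
          by (simp flip: w add: sum.distrib)
        moreover have "card (r (Suc t)) = Suc (card (r t))" using 2 finR[OF clique] by simp
        ultimately show ?thesis by (simp add: M_def)
      next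
        case (3 v)
        then have "card (r (Suc t)) < card (r t)"
          using finR[OF clique, of t] by (metis card_Diff1_less)
        moreover have "(\<Sum>j\<le>m. gap_weight g j (gap (Suc t) j)) \<le> (\<Sum>j\<le>m. gap_weight g j (gap t j))"
          using 3 by (intro sum_mono gap_weight_mono fin shrink) auto
        ultimately show ?thesis by (simp add: M_def)
      qed
    qed
    have "M t + t \<le> M 0" for t
    proof (induction t)
      case (Suc t)
      then show ?case using dec[of t] by linarith
    qed simp
    from this[of "Suc (M 0)"] show False by simp
  qed
  ultimately show ?thesis unfolding cops_win_def by blast
qed

section \<open>Clique number and chromatic number\<close>

lemma ex_clique_card_clique_number:
  assumes "pair_graph G"
  shows "\<exists>K. is_clique G K \<and> finite K \<and> card K = clique_number G"
proof -
  interpret pair_graph G by (rule assms)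
  have "finite {K. is_clique G K}"
    by (rule finite_subset[of _ "Pow (pverts G)"]) (auto simp: is_clique_def pair_finite_verts)
  moreover have "{K. is_clique G K} \<noteq> {}" using is_clique_empty by blast
  ultimately have "clique_number G \<in> card ` {K. is_clique G K}"
    unfolding clique_number_def by (intro Max_in) auto
  then obtain K where K: "is_clique G K" "card K = clique_number G" by auto
  moreover have "finite K"
    using K(1) finite_subset[OF _ pair_finite_verts] by (simp add: is_clique_def)
  ultimately show ?thesis by blast
qed

text \<open>An injective numbering of the finite vertex set is a proper colouring, as there are no
  loops; hence the minimum is attained.\<close>

lemma ex_coloring_chromatic_number:
  assumes "pair_graph G"
  shows "\<exists>f. proper_coloring G (chromatic_number G) f"
proof -
  interpret pair_graph G by (rule assms)
  obtain f :: "'a \<Rightarrow> nat" where f: "bij_betw f (pverts G) {0..<card (pverts G)}"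
    using ex_bij_betw_finite_nat[OF pair_finite_verts] by blast
  have "proper_coloring G (card (pverts G)) f"
    unfolding proper_coloring_def
  proof (intro conjI ballI)
    show "f v < card (pverts G)" if "v \<in> pverts G" for v
      using f that by (auto simp: bij_betw_def)
    show "case e of (u, v) \<Rightarrow> f u \<noteq> f v" if "e \<in> parcs G" for e
    proof -
      obtain u v where e: "e = (u, v)" by fastforce
      with that have "u \<in> pverts G" "v \<in> pverts G" "u \<noteq> v"
        using in_arcsD1 in_arcsD2 pair_no_loops[of "(u, v)"] by auto
      with f e show ?thesis by (auto simp: bij_betw_def inj_on_def)
    qed
  qed
  then have "\<exists>k f. proper_coloring G k f" by blast
  then show ?thesis unfolding chromatic_number_def by (rule LeastI_ex)
qed

theorem theorem3p8:
  fixes G :: "'a pair_pre_digraph"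
  assumes "pair_graph G"
  shows "\<lceil>(real (clique_number G) + 1) / 2\<rceil> \<le> int (cop_number (simplex_graph G))
       \<and> int (cop_number (simplex_graph G)) \<le> \<lceil>(real (chromatic_number G) + 1) / 2\<rceil>
       \<and> (perfect G \<longrightarrow>
            int (cop_number (simplex_graph G)) = \<lceil>(real (clique_number G) + 1) / 2\<rceil>
          \<and> \<lceil>(real (clique_number G) + 1) / 2\<rceil> = \<lceil>(real (chromatic_number G) + 1) / 2\<rceil>)"
proof -
  interpret pair_graph G by (rule assms)
  let ?c = "cop_number (simplex_graph G)"
  obtain f where f: "proper_coloring G (chromatic_number G) f"
    using ex_coloring_chromatic_number[OF assms] by blast
  \<comment> \<open>For \<open>m = chromatic_number G div 2\<close> the number of colours is at most
    \<open>2 * m + 1\<close>, and \<open>Suc m\<close> is the claimed ceiling.\<close>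
  have win: "cops_win (simplex_graph G) (Suc (chromatic_number G div 2))"
    by (rule coloring_cops_win[OF assms f]) linarith
  then have "?c \<le> Suc (chromatic_number G div 2)"
    unfolding cop_number_def by (rule Least_le)
  moreover have "int (Suc (chromatic_number G div 2)) \<le> \<lceil>(real (chromatic_number G) + 1) / 2\<rceil>"
  proof -
    have "real (2 * (chromatic_number G div 2)) \<le> real (chromatic_number G)"
      by (simp only: of_nat_le_iff times_div_less_eq_dividend)
    then show ?thesis by (simp add: le_ceiling_iff)
  qed
  ultimately have upper: "int ?c \<le> \<lceil>(real (chromatic_number G) + 1) / 2\<rceil>" by linarith
  obtain K where K: "is_clique G K" "finite K" "card K = clique_number G"
    using ex_clique_card_clique_number[OF assms] by blast
  have "cops_win (simplex_graph G) ?c"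
    unfolding cop_number_def by (rule LeastI[of "cops_win (simplex_graph G)", OF win])
  \<comment> \<open>By integrality \<open>2 * ?c\<close> is at least
    \<open>clique_number G + 1\<close>, and halving gives the lower bound.\<close>
  then have "\<not> 2 * ?c \<le> clique_number G"
    using clique_evasion[OF K(1,2)] K(3) by metis
  then have lower: "\<lceil>(real (clique_number G) + 1) / 2\<rceil> \<le> int ?c"
    by (simp add: ceiling_le_iff)
  \<comment> \<open>Perfection is applied to \<open>G\<close> as an induced subgraph of
    itself.\<close>
  have "chromatic_number G = clique_number G" if "perfect G"
    using that induced_subgraph_refl by (auto simp: perfect_def)
  with lower upper show ?thesis by auto
qed

end
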